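(* The space $\tilde{\mathbb{I}}$ with the order topology induced by the linear order $<_{\mathrm{XY}}$ is connected.
   Context: $\tilde{\mathbb{I}}=\{\langle\mu,\nu\rangle\in[0,1]^2 \mid \mu+\nu\le 1\}$ is the set of intuitionistic fuzzy values. For $\alpha=\langle\mu_\alpha,\nu_\alpha\rangle\in\tilde{\mathbb{I}}$ put $s(\alpha)=\mu_\alpha-\nu_\alpha$ and $h(\alpha)=\mu_\alpha+\nu_\alpha$. Define $\alpha<_{\mathrm{XY}}\beta$ iff $s(\alpha)<s(\beta)$, or $s(\alpha)=s(\beta)$ and $h(\alpha)<h(\beta)$. The order topology on a linearly ordered set $X$ has as a basis all intervals $(a,b)$, $(\leftarrow,b)=\{x: x<b\}$ and $(a,\rightarrow)=\{x: a<x\}$. *)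

theory Defs
  imports "HOL-Analysis.Analysis"
begin

text \<open>The space of intuitionistic fuzzy values is introduced as a type of its own, so that the
  order and its order topology can be given as instances of the library type classes.\<close>

typedef ifv = "{(m :: real, n :: real). m \<in> {0..1} \<and> n \<in> {0..1} \<and> m + n \<le> 1}"
  by (rule exI[of _ "(0, 0)"]) simp

definition ifv_mu :: "ifv \<Rightarrow> real" where
  "ifv_mu a = fst (Rep_ifv a)"

definition ifv_nu :: "ifv \<Rightarrow> real" where
  "ifv_nu a = snd (Rep_ifv a)"

definition score :: "ifv \<Rightarrow> real" where
  "score a = ifv_mu a - ifv_nu a"

definition accuracy :: "ifv \<Rightarrow> real" where
  "accuracy a = ifv_mu a + ifv_nu a"

lemma ifv_eqI: "a = b" if "score a = score b" "accuracy a = accuracy b"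
proof -
  have "ifv_mu a = ifv_mu b" "ifv_nu a = ifv_nu b"
    using that unfolding score_def accuracy_def by linarith+
  then show ?thesis
    unfolding ifv_mu_def ifv_nu_def by (metis Rep_ifv_inject prod_eqI)
qed

instantiation ifv :: linorder
begin

definition less_ifv :: "ifv \<Rightarrow> ifv \<Rightarrow> bool" where
  "a < b \<longleftrightarrow> score a < score b \<or> (score a = score b \<and> accuracy a < accuracy b)"

definition less_eq_ifv :: "ifv \<Rightarrow> ifv \<Rightarrow> bool" where
  "a \<le> b \<longleftrightarrow> a < b \<or> a = b" for a b :: ifv

instance
  by standard (auto simp: less_ifv_def less_eq_ifv_def intro: ifv_eqI)

end

text \<open>The class fixes the topology to be the one generated by the open rays; the lemma
  \<open>ifv_interval_basis\<close> below confirms that the open intervals together with the open rays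
  form a basis of it.\<close>

instantiation ifv :: linorder_topology
begin

definition open_ifv :: "ifv set \<Rightarrow> bool" where
  "open_ifv = generate_topology (range (\<lambda>a. {..<a}) \<union> range (\<lambda>a. {a<..}))"

instance
  by standard (simp add: open_ifv_def)

end

lemma ifv_neq_ex: "\<exists>y. y \<noteq> x" for x :: ifv
proof -
  have "Abs_ifv (0, 0) \<noteq> Abs_ifv (1, 0)"
    by (subst Abs_ifv_inject) auto
  then show ?thesis
    by metis
qed

lemma ifv_interval_basis:
  "topological_basis
     ({{a<..<b} | a b :: ifv. True} \<union> range (\<lambda>b. {..<b}) \<union> range (\<lambda>a. {a<..}))"
  (is "topological_basis ?B")
proof (rule topological_basisI)
  show "open I" if "I \<in> ?B" for I
    using that by auto
next
  fix S :: "ifv set" and x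
  assume S: "open S" "x \<in> S"
  have up: "\<exists>b>x. {x..<b} \<subseteq> S" if "x < y" for y
    using open_right[OF S that] .
  have down: "\<exists>a<x. {a<..x} \<subseteq> S" if "y < x" for y
    using open_left[OF S that] .
  consider (mid) y z where "y < x" "x < z" | (top) y where "y < x" "\<And>z. z \<le> x"
    | (bot) z where "x < z" "\<And>y. x \<le> y"
    using ifv_neq_ex[of x] by (metis linorder_less_linear not_le)
  then show "\<exists>I\<in>?B. x \<in> I \<and> I \<subseteq> S"
  proof cases
    case mid
    then obtain a b where ab: "a < x" "{a<..x} \<subseteq> S" "x < b" "{x..<b} \<subseteq> S"
      using up down by metis
    have "{a<..<b} \<subseteq> {a<..x} \<union> {x..<b}"
      by auto
    then have "{a<..<b} \<subseteq> S"
      using ab by blast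
    moreover have "{a<..<b} \<in> ?B"
      by blast
    ultimately show ?thesis
      using ab by (intro bexI[of _ "{a<..<b}"]) auto
  next
    case top
    then obtain a where a: "a < x" "{a<..x} \<subseteq> S"
      using down by metis
    have "{a<..} \<subseteq> S"
      using a top(2) by auto
    moreover have "{a<..} \<in> ?B"
      by blast
    ultimately show ?thesis
      using a by (intro bexI[of _ "{a<..}"]) auto
  next
    case bot
    then obtain b where b: "x < b" "{x..<b} \<subseteq> S"
      using up by metis
    have "{..<b} \<subseteq> S"
      using b bot(2) by auto
    moreover have "{..<b} \<in> ?B"
      by blast
    ultimately show ?thesis
      using b by (intro bexI[of _ "{..<b}"]) auto
  qed
qed

end

theory Submission
  imports Defs
begin

text \<open>In the coordinates (score, accuracy) the order is the lexicographic one on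
  \<open>{(s, h). \<bar>s\<bar> \<le> h \<and> h \<le> 1}\<close>. It is dense, and it is complete because every fibre of the score is a
  compact interval: the supremum of a set sits over the supremum \<open>s\<close> of the scores, at the supremum
  of the accuracies occurring over \<open>s\<close>, or at the bottom \<open>\<bar>s\<bar>\<close> of the fibre if there are none. So the
  fuzzy values form a linear continuum, and these are connected in their order topology.\<close>

text \<open>Inverse of the coordinate change to (score, accuracy). Its values are meaningful only
  for \<open>\<bar>s\<bar> \<le> h\<close> and \<open>h \<le> 1\<close>, where the pair lies in the
  carrier of the type.\<close>

definition ifv_of :: "real \<Rightarrow> real \<Rightarrow> ifv" where
  "ifv_of s h = Abs_ifv ((h + s) / 2, (h - s) / 2)"

lemma
  assumes "\<bar>s\<bar> \<le> h" "h \<le> 1"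
  shows score_ifv_of: "score (ifv_of s h) = s"
    and accuracy_ifv_of: "accuracy (ifv_of s h) = h"
proof -
  have "((h + s) / 2, (h - s) / 2) \<in> {(m :: real, n :: real). m \<in> {0..1} \<and> n \<in> {0..1} \<and> m + n \<le> 1}"
    using assms by (auto simp: field_simps)
  then have "Rep_ifv (ifv_of s h) = ((h + s) / 2, (h - s) / 2)"
    unfolding ifv_of_def by (rule Abs_ifv_inverse)
  then show "score (ifv_of s h) = s" "accuracy (ifv_of s h) = h"
    by (auto simp: score_def accuracy_def ifv_mu_def ifv_nu_def field_simps)
qed

lemma abs_score_le_accuracy: "\<bar>score a\<bar> \<le> accuracy a"
  and accuracy_le_1: "accuracy a \<le> 1"
  using Rep_ifv[of a] by (auto simp: score_def accuracy_def ifv_mu_def ifv_nu_def)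

lemma abs_score_le_1: "\<bar>score a\<bar> \<le> 1"
  using abs_score_le_accuracy accuracy_le_1 by (rule order_trans)

lemma bdd_above_score: "bdd_above (score ` A)"
  using abs_score_le_1 by (intro bdd_aboveI[of _ 1]) (auto simp: abs_le_iff)

text \<open>Guarantees that the fibre over the supremum of the scores is inhabited. Since all scores
  are at least -1, a single element of \<open>A\<close> gives the lower bound.\<close>

lemma abs_Sup_score_le_1:
  assumes "A \<noteq> {}"
  shows "\<bar>Sup (score ` A)\<bar> \<le> 1"
proof -
  obtain a where a: "a \<in> A"
    using assms by blast
  have "Sup (score ` A) \<le> 1"
    using assms abs_score_le_1 by (intro cSup_least) (auto simp: abs_le_iff)
  moreover have "score a \<le> Sup (score ` A)"
    using a bdd_above_score by (intro cSup_upper) auto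
  ultimately show ?thesis
    using abs_score_le_1[of a] by linarith
qed

lemma score_mono: "a \<le> b \<Longrightarrow> score a \<le> score b"
  by (auto simp: less_eq_ifv_def less_ifv_def)

lemma ifv_le_iff: "a \<le> b \<longleftrightarrow> score a < score b \<or> score a = score b \<and> accuracy a \<le> accuracy b"
  by (auto simp: less_eq_ifv_def less_ifv_def intro: ifv_eqI)

text \<open>The inserted bottom of the fibre is the default when no element of \<open>A\<close>
  attains the supremum of the scores; otherwise it leaves the supremum unchanged, as no accuracy in
  that fibre lies below it.\<close>

definition top_accuracies :: "ifv set \<Rightarrow> real set" where
  "top_accuracies A = insert \<bar>Sup (score ` A)\<bar> (accuracy ` {a \<in> A. score a = Sup (score ` A)})"

lemma bdd_above_top_accuracies: "bdd_above (top_accuracies A)"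
  using accuracy_le_1 unfolding top_accuracies_def bdd_above_insert by (intro bdd_aboveI[of _ 1]) auto

definition ifv_Sup :: "ifv set \<Rightarrow> ifv" where
  "ifv_Sup A = ifv_of (Sup (score ` A)) (Sup (top_accuracies A))"

lemma
  assumes "A \<noteq> {}"
  shows score_ifv_Sup: "score (ifv_Sup A) = Sup (score ` A)"
    and accuracy_ifv_Sup: "accuracy (ifv_Sup A) = Sup (top_accuracies A)"
proof -
  have "\<bar>Sup (score ` A)\<bar> \<le> Sup (top_accuracies A)"
    using bdd_above_top_accuracies by (intro cSup_upper) (auto simp: top_accuracies_def)
  moreover have "Sup (top_accuracies A) \<le> 1"
    using accuracy_le_1 abs_Sup_score_le_1[OF assms]
    by (intro cSup_least) (auto simp: top_accuracies_def)
  ultimately show "score (ifv_Sup A) = Sup (score ` A)"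
    and "accuracy (ifv_Sup A) = Sup (top_accuracies A)"
    unfolding ifv_Sup_def by (rule score_ifv_of accuracy_ifv_of)+
qed

lemma ifv_Sup_upper:
  assumes "a \<in> A"
  shows "a \<le> ifv_Sup A"
proof -
  have "A \<noteq> {}"
    using assms by blast
  note Sup_eqs = score_ifv_Sup[OF this] accuracy_ifv_Sup[OF this]
  have "score a \<le> Sup (score ` A)"
    using assms bdd_above_score by (intro cSup_upper) auto
  moreover have "accuracy a \<le> Sup (top_accuracies A)" if "score a = Sup (score ` A)"
    using assms that bdd_above_top_accuracies by (intro cSup_upper) (auto simp: top_accuracies_def)
  ultimately show ?thesis
    unfolding ifv_le_iff Sup_eqs by linarith
qed

lemma ifv_Sup_least:
  assumes "A \<noteq> {}" and ub: "\<And>a. a \<in> A \<Longrightarrow> a \<le> b"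
  shows "ifv_Sup A \<le> b"
proof -
  note Sup_eqs = score_ifv_Sup[OF assms(1)] accuracy_ifv_Sup[OF assms(1)]
  have "Sup (score ` A) \<le> score b"
    using assms score_mono by (intro cSup_least) auto
  moreover have "Sup (top_accuracies A) \<le> accuracy b" if "Sup (score ` A) = score b"
  proof (rule cSup_least)
    show "top_accuracies A \<noteq> {}"
      by (simp add: top_accuracies_def)
    \<comment> \<open>The inserted value equals \<open>\<bar>score b\<bar>\<close>; any other
      \<open>h\<close> comes from an element of \<open>A\<close> with the same score as
      \<open>b\<close>, so \<open>ub\<close> compares accuracies.\<close>
    show "h \<le> accuracy b" if "h \<in> top_accuracies A" for h
      using that \<open>Sup (score ` A) = score b\<close> ub abs_score_le_accuracy[of b]
      by (fastforce simp: top_accuracies_def ifv_le_iff)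
  qed
  ultimately show ?thesis
    unfolding ifv_le_iff Sup_eqs by linarith
qed

instantiation ifv :: linear_continuum
begin

definition Sup_ifv :: "ifv set \<Rightarrow> ifv" where
  "Sup A = ifv_Sup A"

definition Inf_ifv :: "ifv set \<Rightarrow> ifv" where
  "Inf A = ifv_Sup {b. \<forall>a\<in>A. b \<le> a}"

definition sup_ifv :: "ifv \<Rightarrow> ifv \<Rightarrow> ifv" where
  "sup_ifv = max"

definition inf_ifv :: "ifv \<Rightarrow> ifv \<Rightarrow> ifv" where
  "inf_ifv = min"

instance
proof
  show "Inf A \<le> a" if "a \<in> A" "bdd_below A" for a and A :: "ifv set"
    \<comment> \<open>Boundedness below makes the set of lower bounds nonempty, and \<open>a\<close>
      is an upper bound of that set.\<close>
    using that unfolding Inf_ifv_def by (intro ifv_Sup_least) (auto simp: bdd_below_def)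
  show "b \<le> Inf A" if "A \<noteq> {}" "\<And>a. a \<in> A \<Longrightarrow> b \<le> a" for b and A :: "ifv set"
    using that unfolding Inf_ifv_def by (intro ifv_Sup_upper) auto
  show "a \<le> Sup A" if "a \<in> A" "bdd_above A" for a and A :: "ifv set"
    using that unfolding Sup_ifv_def by (intro ifv_Sup_upper)
  show "Sup A \<le> b" if "A \<noteq> {}" "\<And>a. a \<in> A \<Longrightarrow> a \<le> b" for b and A :: "ifv set"
    using that unfolding Sup_ifv_def by (intro ifv_Sup_least)
  show "\<exists>c. a < c \<and> c < b" if "a < b" for a b :: ifv
  proof (cases "score a < score b")
    case True
    define s where "s = (score a + score b) / 2"
    have s: "score a < s" "s < score b"
      using True by (auto simp: s_def)
    then have "\<bar>s\<bar> \<le> 1"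
      using abs_score_le_1[of a] abs_score_le_1[of b] by linarith
    \<comment> \<open>Accuracy 1 is the top of every fibre, hence admissible for any score
      \<open>s\<close> in [-1, 1].\<close>
    then have "score (ifv_of s 1) = s"
      by (simp add: score_ifv_of)
    then show ?thesis
      using s by (intro exI[of _ "ifv_of s 1"]) (simp add: less_ifv_def)
  next
    case False
    then have ab: "score a = score b" "accuracy a < accuracy b"
      using that by (auto simp: less_ifv_def)
    define h where "h = (accuracy a + accuracy b) / 2"
    have h: "accuracy a < h" "h < accuracy b"
      using ab by (auto simp: h_def)
    \<comment> \<open>The fibre is an interval, so the midpoint of two accuracies stays in
      it.\<close>
    then have "\<bar>score a\<bar> \<le> h" "h \<le> 1"
      using abs_score_le_accuracy[of a] accuracy_le_1[of b] by linarith+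
    then have "score (ifv_of (score a) h) = score a" "accuracy (ifv_of (score a) h) = h"
      by (simp_all add: score_ifv_of accuracy_ifv_of)
    then show ?thesis
      using h ab by (intro exI[of _ "ifv_of (score a) h"]) (simp add: less_ifv_def)
  qed
  show "\<exists>a b :: ifv. a \<noteq> b"
    using ifv_neq_ex by blast
qed (auto simp: sup_ifv_def inf_ifv_def)

end

instance ifv :: linear_continuum_topology ..

theorem proposition5p2:
  shows "connected (UNIV :: ifv set)"
  \<comment> \<open>In a linear continuum every order-convex set is connected, and the whole space
    is trivially order-convex.\<close>
  by (rule connectedI_interval) simp

end
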